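(* (i) $Z_{DP}(C_4)=1$, where $C_4$ is the cycle on four vertices. (ii) For any graph $G$ with $n$ vertices, if $\chi(G)=n-2$ and $G\not\cong C_4$, then $\chi_{DP}(G)=\chi(G)$.
   Context: All graphs are finite and simple; $\mathbb{N}$ is the set of non-negative integers; $\chi(G)$ is the chromatic number. For vertex-disjoint graphs $G_1,G_2$, the join $G_1\vee G_2$ has vertex set $V(G_1)\cup V(G_2)$ and edge set $E(G_1)\cup E(G_2)\cup\{v_1v_2: v_1\in V(G_1),v_2\in V(G_2)\}$. $K_m$ is the complete graph on $m$ vertices, and $G\vee K_0=G$. A cover of a graph $G$ is an ordered pair $\mathcal{H}=(L,H)$, where $H$ is a graph and $L$ is a mapping from $V(G)$ to the power set of $V(H)$ such that: (1) the sets $L(u)$, $u\in V(G)$, partition $V(H)$; (2) for every $u\in V(G)$, the induced subgraph $H[L(u)]$ is complete; (3) if $u\ne v$ are not adjacent in $G$, then there are no edges of $H$ between $L(u)$ and $L(v)$; (4) for each edge $uv\in E(G)$, the set of edges of $H$ between $L(u)$ and $L(v)$ is a (not necessarily perfect, possibly empty) matching. The cover is $m$-fold if $|L(v)|=m$ for all $v\in V(G)$. An $\mathcal{H}$-coloring of $G$ is an independent set in $H$ of size $|V(G)|$; $G$ is $\mathcal{H}$-colorable if it has an $\mathcal{H}$-coloring. The DP-chromatic number $\chi_{DP}(G)$ is the minimum positive integer $m$ such that $G$ is $\mathcal{H}$-colorable for each $m$-fold cover $\mathcal{H}$ of $G$. For a graph $G$, $Z_{DP}(G)=\min\{m\in\mathbb{N}: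 \chi_{DP}(G\vee K_m)=\chi(G\vee K_m)\}$. *)

theory Defs
  imports "HOL-Library.Ramsey" "HOL-Library.Disjoint_Sets"
begin

record 'a graph =
  verts :: "'a set"
  edges :: "'a set set"

definition simple_graph :: "'a graph \<Rightarrow> bool" where
  "simple_graph G \<longleftrightarrow> finite (verts G) \<and> edges G \<subseteq> [verts G]\<^bsup>2\<^esup>"

definition graph_iso :: "'a graph \<Rightarrow> 'b graph \<Rightarrow> bool" where
  "graph_iso G H \<longleftrightarrow>
     (\<exists>f. bij_betw f (verts G) (verts H) \<and>
          (\<forall>u\<in>verts G. \<forall>v\<in>verts G. {u, v} \<in> edges G \<longleftrightarrow> {f u, f v} \<in> edges H))"

definition complete_graph :: "nat \<Rightarrow> nat graph" where
  "complete_graph m = \<lparr>verts = {..<m}, edges = [{..<m}]\<^bsup>2\<^esup>\<rparr>"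

(* The n-cycle, for n \<ge> 3. *)
definition cycle_graph :: "nat \<Rightarrow> nat graph" where
  "cycle_graph n = \<lparr>verts = {..<n}, edges = {{i, Suc i mod n} | i. i < n}\<rparr>"

(* The sum type supplies vertex-disjoint copies of the two graphs. *)
definition graph_join :: "'a graph \<Rightarrow> 'b graph \<Rightarrow> ('a + 'b) graph" (infixl "\<or>\<^sub>g" 65) where
  "G1 \<or>\<^sub>g G2 =
     \<lparr>verts = verts G1 <+> verts G2,
      edges = (\<lambda>e. Inl ` e) ` edges G1 \<union> (\<lambda>e. Inr ` e) ` edges G2 \<union>
              {{Inl u, Inr v} | u v. u \<in> verts G1 \<and> v \<in> verts G2}\<rparr>"

definition proper_coloring :: "'a graph \<Rightarrow> nat \<Rightarrow> ('a \<Rightarrow> nat) \<Rightarrow> bool" where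
  "proper_coloring G k c \<longleftrightarrow>
     c ` verts G \<subseteq> {..<k} \<and>
     (\<forall>u\<in>verts G. \<forall>v\<in>verts G. {u, v} \<in> edges G \<longrightarrow> c u \<noteq> c v)"

definition chromatic_number :: "'a graph \<Rightarrow> nat" where
  "chromatic_number G = (LEAST k. \<exists>c. proper_coloring G k c)"

definition edges_between :: "'b graph \<Rightarrow> 'b set \<Rightarrow> 'b set \<Rightarrow> 'b set set" where
  "edges_between H A B = {{x, y} | x y. x \<in> A \<and> y \<in> B \<and> {x, y} \<in> edges H}"

(* A set of edges is a matching iff it is pairwise disjoint. *)
definition dp_cover :: "'a graph \<Rightarrow> ('a \<Rightarrow> 'b set) \<Rightarrow> 'b graph \<Rightarrow> bool" where
  "dp_cover G L H \<longleftrightarrow>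
     simple_graph H \<and>
     disjoint_family_on L (verts G) \<and> (\<Union>u\<in>verts G. L u) = verts H \<and>
     (\<forall>u\<in>verts G. clique (L u) (edges H)) \<and>
     (\<forall>u\<in>verts G. \<forall>v\<in>verts G.
        u \<noteq> v \<and> {u, v} \<notin> edges G \<longrightarrow> edges_between H (L u) (L v) = {}) \<and>
     (\<forall>u\<in>verts G. \<forall>v\<in>verts G.
        {u, v} \<in> edges G \<longrightarrow> disjoint (edges_between H (L u) (L v)))"

definition fold_cover :: "nat \<Rightarrow> 'a graph \<Rightarrow> ('a \<Rightarrow> 'b set) \<Rightarrow> 'b graph \<Rightarrow> bool" where
  "fold_cover m G L H \<longleftrightarrow> dp_cover G L H \<and> (\<forall>v\<in>verts G. card (L v) = m)"

definition cover_colorable :: "'a graph \<Rightarrow> 'b graph \<Rightarrow> bool" where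
  "cover_colorable G H \<longleftrightarrow>
     (\<exists>I. I \<subseteq> verts H \<and> indep I (edges H) \<and> card I = card (verts G))"

(* Covers are finite graphs, so it suffices to let them range over graphs on natural numbers;
   see dp_colorable_any_type below. *)
definition dp_colorable :: "nat \<Rightarrow> 'a graph \<Rightarrow> bool" where
  "dp_colorable m G \<longleftrightarrow>
     (\<forall>L (H :: nat graph). fold_cover m G L H \<longrightarrow> cover_colorable G H)"

definition dp_chromatic_number :: "'a graph \<Rightarrow> nat" where
  "dp_chromatic_number G = (LEAST m. 0 < m \<and> dp_colorable m G)"

definition Z_DP :: "'a graph \<Rightarrow> nat" where
  "Z_DP G = (LEAST m. dp_chromatic_number (G \<or>\<^sub>g complete_graph m) =
                      chromatic_number (G \<or>\<^sub>g complete_graph m))"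

lemma dp_colorable_any_type:
  fixes H :: "'b graph"
  assumes "dp_colorable m G" and cov: "fold_cover m G L H"
  shows "cover_colorable G H"
proof -
  have fin: "finite (verts H)" and E: "edges H \<subseteq> [verts H]\<^bsup>2\<^esup>"
    and LV: "(\<Union>u\<in>verts G. L u) = verts H"
    using cov by (auto simp: fold_cover_def dp_cover_def simple_graph_def)
  obtain f :: "'b \<Rightarrow> nat" where f: "inj_on f (verts H)"
    using finite_imp_inj_to_nat_seg[OF fin] by metis
  define H' where "H' = \<lparr>verts = f ` verts H, edges = (`) f ` edges H\<rparr>"
  define L' where "L' = (\<lambda>u. f ` L u)"
  have edge: "f ` e \<in> edges H' \<longleftrightarrow> e \<in> edges H" if "e \<subseteq> verts H" for e
  proof
    assume "f ` e \<in> edges H'"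
    then obtain e' where e': "e' \<in> edges H" "f ` e = f ` e'" by (auto simp: H'_def)
    moreover have "e' \<subseteq> verts H" using E e' by (auto simp: nsets_def)
    ultimately show "e \<in> edges H" using inj_on_image_eq_iff[OF f that] by auto
  qed (auto simp: H'_def)
  have edge2: "{f x, f y} \<in> edges H' \<longleftrightarrow> {x, y} \<in> edges H"
    if "x \<in> verts H" "y \<in> verts H" for x y
    using edge[of "{x, y}"] that by simp
  have sub: "L u \<subseteq> verts H" if "u \<in> verts G" for u using LV that by auto
  have between: "edges_between H' (L' u) (L' v) = (`) f ` edges_between H (L u) (L v)"
    if "u \<in> verts G" "v \<in> verts G" for u v
  proof -
    have *: "{f x, f y} \<in> edges H' \<longleftrightarrow> {x, y} \<in> edges H" if "x \<in> L u" "y \<in> L v" for x y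
      using edge2 sub \<open>u \<in> verts G\<close> \<open>v \<in> verts G\<close> that by blast
    have "edges_between H' (L' u) (L' v) =
        {{f x, f y} | x y. x \<in> L u \<and> y \<in> L v \<and> {f x, f y} \<in> edges H'}"
      unfolding edges_between_def L'_def by blast
    also have "\<dots> = {f ` {x, y} | x y. x \<in> L u \<and> y \<in> L v \<and> {x, y} \<in> edges H}"
      using * by (metis (no_types, lifting) image_empty image_insert)
    also have "\<dots> = (`) f ` edges_between H (L u) (L v)"
      unfolding edges_between_def by blast
    finally show ?thesis .
  qed
  have "fold_cover m G L' H'"
    unfolding fold_cover_def dp_cover_def
  proof (intro conjI ballI impI)
    have "f ` e \<in> [f ` verts H]\<^bsup>2\<^esup>" if "e \<in> edges H" for e
    proof -
      have e: "e \<subseteq> verts H" "finite e" "card e = 2" using E that by (auto simp: nsets_def)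
      then show ?thesis
        using card_image[OF inj_on_subset[OF f e(1)]] by (simp add: nsets_def image_mono)
    qed
    then show "simple_graph H'"
      using fin by (simp add: simple_graph_def H'_def image_subset_iff)
    show "disjoint_family_on L' (verts G)"
      unfolding disjoint_family_on_def
    proof (intro ballI impI)
      fix u v assume uv: "u \<in> verts G" "v \<in> verts G" "u \<noteq> v"
      then have "L u \<inter> L v = {}"
        using cov by (simp add: fold_cover_def dp_cover_def disjoint_family_on_def)
      then show "L' u \<inter> L' v = {}"
        using inj_on_image_Int[OF f sub[OF uv(1)] sub[OF uv(2)]] by (simp add: L'_def)
    qed
    show "(\<Union>u\<in>verts G. L' u) = verts H'"
      by (simp add: L'_def H'_def image_UN flip: LV)
    fix u assume u: "u \<in> verts G"
    show "clique (L' u) (edges H')"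
    proof -
      have "clique (L u) (edges H)" using cov u by (auto simp: fold_cover_def dp_cover_def)
      then show ?thesis using sub[OF u] by (auto simp: clique_def L'_def edge2 subset_iff)
    qed
    show "card (L' u) = m"
      using cov u card_image[OF inj_on_subset[OF f sub[OF u]]]
      by (simp add: fold_cover_def L'_def)
    fix v assume v: "v \<in> verts G"
    show "edges_between H' (L' u) (L' v) = {}" if "u \<noteq> v \<and> {u, v} \<notin> edges G"
      using cov u v that by (simp add: between fold_cover_def dp_cover_def)
    show "disjoint (edges_between H' (L' u) (L' v))" if "{u, v} \<in> edges G"
    proof -
      have "disjoint (edges_between H (L u) (L v))"
        using cov u v that by (simp add: fold_cover_def dp_cover_def)
      moreover have "\<Union> (edges_between H (L u) (L v)) \<subseteq> verts H"
        using sub[OF u] sub[OF v] by (auto simp: edges_between_def)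
      ultimately show ?thesis
        unfolding between[OF u v]
        by (intro disjoint_image) (auto intro: inj_on_subset[OF f])
    qed
  qed
  then obtain I where I: "I \<subseteq> verts H'" "indep I (edges H')" "card I = card (verts G)"
    using assms(1) unfolding dp_colorable_def cover_colorable_def by blast
  then obtain J where J: "J \<subseteq> verts H" "I = f ` J"
    by (auto simp: H'_def subset_image_iff)
  have "card J = card (verts G)"
    using I J card_image[OF inj_on_subset[OF f J(1)]] by simp
  moreover have "indep J (edges H)"
    unfolding indep_def
  proof (intro ballI impI)
    fix v w assume vw: "v \<in> J" "w \<in> J" "v \<noteq> w"
    then have "v \<in> verts H" "w \<in> verts H" using J(1) by auto
    with vw have "f v \<noteq> f w" and e: "{f v, f w} \<in> edges H' \<longleftrightarrow> {v, w} \<in> edges H"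
      using edge2 inj_onD[OF f] by blast+
    then show "{v, w} \<notin> edges H" using I(2) J(2) vw by (simp add: indep_def)
  qed
  ultimately show ?thesis using J(1) by (auto simp: cover_colorable_def)
qed

end

theory Submission
  imports Defs
begin

text \<open>
  For part (ii) let \<open>G\<close> have \<open>n\<close> vertices and put \<open>m = \<chi>(G) = n - 2\<close>. Since \<open>\<chi>\<close> never exceeds
  \<open>\<chi>\<^sub>D\<^sub>P\<close>, it remains to colour every \<open>m\<close>-fold cover of \<open>G\<close>. A proper colouring of \<open>n\<close> vertices with
  \<open>n - 2\<close> colours repeats colours twice, so \<open>G\<close> has either three pairwise nonadjacent vertices
  or two disjoint nonadjacent pairs \<open>a, a'\<close> and \<open>b, b'\<close> (\<open>two_repeated_colors\<close>).

  With three independent vertices, colour all others greedily first; each vertex then meets fewer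
  than \<open>m\<close> coloured neighbours when its turn comes. With two pairs and \<open>n = 4\<close>, a graph
  other than \<open>C\<^sub>4\<close> misses an edge of the four-cycle \<open>a b a' b'\<close> and so lies in a path, which
  is greedily colourable from lists of size two.

  With two pairs and \<open>n \<ge> 5\<close>, pick one more vertex \<open>w\<close> and colour the \<open>m - 3\<close> vertices outside
  \<open>{a, a', b, b', w}\<close> greedily. This leaves three colours on each vertex of a wheel with hub \<open>w\<close>
  and rim \<open>a b a' b'\<close>. If such a cover of the wheel had no colouring, then after any choice
  at the hub the rim could not be coloured. That forces every matching to be perfect and the rim
  matchings to agree with the identification of all lists with the hub list; and once the lists are
  so identified, giving the three colours to the hub, to \<open>a, a'\<close> and to \<open>b, b'\<close> is a colouring
  (\<open>wheel_choice_exists\<close>).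

  For part (i), a twisted 2-fold cover shows that \<open>C\<^sub>4\<close> itself fails, and \<open>C\<^sub>4 \<or> K\<^sub>1\<close>
  has five vertices and chromatic number three, so part (ii) applies to it.
\<close>

section \<open>Greedy colouring of covers\<close>

lemma cover_matching:
  assumes "dp_cover G L H" "u \<in> verts G" "v \<in> verts G" "u \<noteq> v"
    and x: "x \<in> L u" and y: "y \<in> L v" "y' \<in> L v"
    and e: "{x, y} \<in> edges H" "{x, y'} \<in> edges H"
  shows "y = y'"
proof -
  have b: "{x, y} \<in> edges_between H (L u) (L v)" "{x, y'} \<in> edges_between H (L u) (L v)"
    using x y e unfolding edges_between_def by blast+
  then have "{u, v} \<in> edges G" using assms(1-4) unfolding dp_cover_def by blast
  then have "disjoint (edges_between H (L u) (L v))"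
    using assms(1-3) unfolding dp_cover_def by blast
  then have "{x, y} = {x, y'}" using disjointD[OF _ b] by auto
  then show ?thesis by (auto simp: doubleton_eq_iff)
qed

lemma cover_nonadjacent:
  assumes "dp_cover G L H" "u \<in> verts G" "v \<in> verts G" "u \<noteq> v" "{u, v} \<notin> edges G"
    and "x \<in> L u" "y \<in> L v"
  shows "{x, y} \<notin> edges H"
  using assms unfolding dp_cover_def edges_between_def by blast

lemma cover_list_finite:
  assumes "dp_cover G L H" "v \<in> verts G"
  shows "finite (L v)"
proof -
  have "L v \<subseteq> verts H" "finite (verts H)"
    using assms unfolding dp_cover_def simple_graph_def by blast+
  then show ?thesis by (rule finite_subset)
qed

definition partial_coloring :: "('a \<Rightarrow> 'b set) \<Rightarrow> 'b graph \<Rightarrow> 'a set \<Rightarrow> ('a \<Rightarrow> 'b) \<Rightarrow> bool" where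
  "partial_coloring L H S c \<longleftrightarrow>
     (\<forall>v\<in>S. c v \<in> L v) \<and> (\<forall>u\<in>S. \<forall>v\<in>S. u \<noteq> v \<longrightarrow> {c u, c v} \<notin> edges H)"

definition available :: "('a \<Rightarrow> 'b set) \<Rightarrow> 'b graph \<Rightarrow> 'a set \<Rightarrow> ('a \<Rightarrow> 'b) \<Rightarrow> 'a \<Rightarrow> 'b set" where
  "available L H S c v = {x \<in> L v. \<forall>u\<in>S. {c u, x} \<notin> edges H}"

lemma partial_coloring_insert:
  assumes "partial_coloring L H S c" "x \<in> available L H S c v" "v \<notin> S"
  shows "partial_coloring L H (insert v S) (c(v := x))"
  using assms unfolding partial_coloring_def available_def
  by (auto simp: insert_commute)

lemma cover_colorable_if_coloring:
  assumes cov: "dp_cover G L H" and c: "partial_coloring L H (verts G) c"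
  shows "cover_colorable G H"
proof -
  have "inj_on c (verts G)"
  proof (rule inj_onI, rule ccontr)
    fix u v assume *: "u \<in> verts G" "v \<in> verts G" "c u = c v" "u \<noteq> v"
    then have "c u \<in> L u \<inter> L v" using c unfolding partial_coloring_def by force
    then show False using cov * unfolding dp_cover_def disjoint_family_on_def by blast
  qed
  then have "card (c ` verts G) = card (verts G)" by (rule card_image)
  moreover have "c ` verts G \<subseteq> verts H"
    using cov c unfolding dp_cover_def partial_coloring_def by blast
  moreover have "indep (c ` verts G) (edges H)"
    using c unfolding partial_coloring_def indep_def by fastforce
  ultimately show ?thesis unfolding cover_colorable_def by blast
qed

text \<open>
  The cover edges into \<open>L v\<close> from a coloured vertex come from a matching, so each coloured neighbour
  removes at most one colour, and other coloured vertices remove none.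
\<close>

lemma card_list_le_available:
  assumes cov: "dp_cover G L H" and S: "finite S" "S \<subseteq> verts G"
    and v: "v \<in> verts G" "v \<notin> S" and c: "partial_coloring L H S c"
  shows "card (L v) \<le> card (available L H S c v) + card {u \<in> S. {u, v} \<in> edges G}"
proof -
  let ?N = "{u \<in> S. {u, v} \<in> edges G}"
  let ?B = "\<lambda>u. {x \<in> L v. {c u, x} \<in> edges H}"
  have fin: "finite (L v)" using cov v by (simp add: cover_list_finite)
  have cS: "c u \<in> L u" if "u \<in> S" for u using c that unfolding partial_coloring_def by blast
  have one: "card (?B u) \<le> 1" if u: "u \<in> ?N" for u
  proof -
    have "x = y" if "x \<in> ?B u" "y \<in> ?B u" for x y
      using cover_matching[OF cov, of u v "c u" x y] that u S v cS by auto
    then show ?thesis using fin by (simp add: card_le_Suc0_iff_eq)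
  qed
  have "L v \<subseteq> available L H S c v \<union> (\<Union>u\<in>?N. ?B u)"
  proof
    fix x assume x: "x \<in> L v"
    have "{u, v} \<in> edges G" if "u \<in> S" "{c u, x} \<in> edges H" for u
      using cover_nonadjacent[OF cov, of u v "c u" x] that S v x cS by blast
    then show "x \<in> available L H S c v \<union> (\<Union>u\<in>?N. ?B u)"
      using x unfolding available_def by blast
  qed
  then have "card (L v) \<le> card (available L H S c v \<union> (\<Union>u\<in>?N. ?B u))"
    using fin S by (intro card_mono) (auto simp: available_def)
  also have "\<dots> \<le> card (available L H S c v) + card (\<Union>u\<in>?N. ?B u)"
    by (rule card_Un_le)
  also have "card (\<Union>u\<in>?N. ?B u) \<le> (\<Sum>u\<in>?N. card (?B u))"
    using S by (intro card_UN_le) auto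
  also have "\<dots> \<le> (\<Sum>u\<in>?N. 1)" using one by (rule sum_mono)
  finally show ?thesis by simp
qed

text \<open>
  Any superset \<open>N\<close> of the coloured neighbours may be used for the count, so that applications
  need not determine the neighbourhood exactly.
\<close>

lemma greedy_step:
  assumes cov: "dp_cover G L H" and S: "finite S" "S \<subseteq> verts G"
    and v: "v \<in> verts G" "v \<notin> S"
    and few: "{u \<in> S. {u, v} \<in> edges G} \<subseteq> N" "finite N" "card N < card (L v)"
    and c: "partial_coloring L H S c"
  shows "\<exists>c'. partial_coloring L H (insert v S) c'"
proof -
  have "card {u \<in> S. {u, v} \<in> edges G} < card (L v)"
    using card_mono[OF few(2,1)] few(3) by simp
  then have "card (available L H S c v) > 0"
    using card_list_le_available[OF cov S v c] by linarith
  then obtain x where "x \<in> available L H S c v" by (auto simp: card_gt_0_iff)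
  then show ?thesis using partial_coloring_insert[OF c _ v(2)] by blast
qed

lemma greedy_small_set:
  assumes cov: "fold_cover m G L H"
    and T: "finite T" "T \<subseteq> verts G" "card T \<le> m"
  shows "\<exists>c. partial_coloring L H T c"
  using T
proof (induction T rule: finite_induct)
  case empty
  show ?case by (simp add: partial_coloring_def)
next
  case (insert v T)
  then obtain c where "partial_coloring L H T c" by auto
  then show ?case
    using cov insert greedy_step[of G L H T v T c] by (auto simp: fold_cover_def)
qed

lemma dp_colorable_card:
  assumes "finite (verts G)" "card (verts G) \<le> m"
  shows "dp_colorable m G"
  unfolding dp_colorable_def
proof (intro allI impI)
  fix L and H :: "nat graph" assume cov: "fold_cover m G L H"
  then obtain c where "partial_coloring L H (verts G) c"
    using greedy_small_set[OF cov assms(1) subset_refl assms(2)] by blast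
  then show "cover_colorable G H"
    using cov cover_colorable_if_coloring by (auto simp: fold_cover_def)
qed

section \<open>Covers given by relations on the colours\<close>

text \<open>
  Covers for the negative results: all lists are copies of \<open>{..<k}\<close>, and the relation \<open>R u v\<close> is
  the matching between the copies at \<open>u\<close> and \<open>v\<close>. An independent set of full size meets each
  list exactly once, as lists are cliques, and so is the graph of a function on the vertices.
\<close>

lemma dp_colorable_relation:
  fixes G :: "'a graph" and R :: "'a \<Rightarrow> 'a \<Rightarrow> nat \<Rightarrow> nat \<Rightarrow> bool"
  assumes G: "simple_graph G" and k: "dp_colorable k G"
    and sym: "\<And>u v i j. R u v i j \<Longrightarrow> R v u j i"
    and fn: "\<And>u v i j j'. \<lbrakk>{u, v} \<in> edges G; i < k; j < k; j' < k; R u v i j; R u v i j'\<rbrakk> \<Longrightarrow> j = j'"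
  shows "\<exists>c. c ` verts G \<subseteq> {..<k} \<and>
    (\<forall>u\<in>verts G. \<forall>v\<in>verts G. {u, v} \<in> edges G \<longrightarrow> \<not> R u v (c u) (c v))"
proof -
  let ?V = "verts G"
  define adj where "adj = (\<lambda>(u :: 'a, i :: nat) (v :: 'a, j :: nat).
    u \<in> ?V \<and> v \<in> ?V \<and> i < k \<and> j < k \<and> (u = v \<and> i \<noteq> j \<or> {u, v} \<in> edges G \<and> R u v i j))"
  define H where "H = \<lparr>verts = ?V \<times> {..<k}, edges = {{p, q} | p q. adj p q}\<rparr>"
  define L where "L = (\<lambda>u :: 'a. {u} \<times> {..<k})"
  have fin: "finite ?V" and noloop: "{u, u} \<notin> edges G" for u
    using G by (auto simp: simple_graph_def nsets_def)
  have adj_sym: "adj p q \<longleftrightarrow> adj q p" for p q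
    using sym by (auto simp: adj_def insert_commute split: prod.splits)
  have edge: "{p, q} \<in> edges H \<longleftrightarrow> adj p q" for p q
    using adj_sym[of p q] unfolding H_def graph.simps mem_Collect_eq doubleton_eq_iff by blast
  have cov: "fold_cover k G L H"
    unfolding fold_cover_def dp_cover_def
  proof (intro conjI ballI impI)
    have "p \<noteq> q \<and> p \<in> verts H \<and> q \<in> verts H" if "adj p q" for p q
      using that noloop by (auto simp: adj_def H_def)
    then show "simple_graph H"
      using fin by (fastforce simp: simple_graph_def H_def nsets_def)
    show "disjoint_family_on L ?V" by (auto simp: disjoint_family_on_def L_def)
    show "(\<Union>u\<in>?V. L u) = verts H" by (auto simp: L_def H_def)
    fix u assume u: "u \<in> ?V"
    show "clique (L u) (edges H)"
      using u by (auto simp: clique_def L_def edge adj_def)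
    show "card (L u) = k" by (simp add: L_def card_cartesian_product)
    fix v assume v: "v \<in> ?V"
    show "edges_between H (L u) (L v) = {}" if "u \<noteq> v \<and> {u, v} \<notin> edges G"
      using that by (auto simp: edges_between_def edge L_def adj_def)
    show "disjoint (edges_between H (L u) (L v))" if uv: "{u, v} \<in> edges G"
    proof -
      have "u \<noteq> v" using uv noloop by auto
      have vu: "{v, u} \<in> edges G" using uv by (simp add: insert_commute)
      have eb: "edges_between H (L u) (L v) =
          {{(u, i), (v, j)} | i j. i < k \<and> j < k \<and> R u v i j}"
        using u v uv \<open>u \<noteq> v\<close> by (auto simp: edges_between_def edge L_def adj_def)
      have "i = i' \<longleftrightarrow> j = j'" if "i < k" "j < k" "i' < k" "j' < k" "R u v i j" "R u v i' j'" for i j i' j'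
        using that(1-4) fn[OF uv, of i j j'] fn[OF vu, of j i i'] that(5,6)
          sym[OF that(5)] sym[OF that(6)] by auto
      then show ?thesis
        using \<open>u \<noteq> v\<close> unfolding eb disjoint_def by (auto simp: doubleton_eq_iff)
    qed
  qed
  then obtain I where I: "I \<subseteq> verts H" "indep I (edges H)" "card I = card ?V"
    using dp_colorable_any_type[OF k] unfolding cover_colorable_def by blast
  have "inj_on fst I"
  proof (rule inj_onI, rule ccontr)
    fix p q assume pq: "p \<in> I" "q \<in> I" "fst p = fst q" "p \<noteq> q"
    then have "adj p q" using I(1) by (auto simp: adj_def H_def)
    then show False using I(2) pq edge by (auto simp: indep_def)
  qed
  then have "card (fst ` I) = card ?V" using I(3) by (simp add: card_image)
  moreover have "fst ` I \<subseteq> ?V" using I(1) by (auto simp: H_def)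
  ultimately have "fst ` I = ?V" using fin by (simp add: card_subset_eq)
  then have "\<forall>u\<in>?V. \<exists>i. (u, i) \<in> I" by force
  then obtain c where c: "\<And>u. u \<in> ?V \<Longrightarrow> (u, c u) \<in> I" by metis
  have "c ` ?V \<subseteq> {..<k}" using c I(1) by (auto simp: H_def)
  moreover have "\<not> R u v (c u) (c v)" if uv: "u \<in> ?V" "v \<in> ?V" "{u, v} \<in> edges G" for u v
  proof
    assume "R u v (c u) (c v)"
    then have "adj (u, c u) (v, c v)" using uv \<open>c ` ?V \<subseteq> {..<k}\<close> by (auto simp: adj_def)
    moreover have "u \<noteq> v" using uv noloop by auto
    ultimately show False using I(2) c uv edge by (auto simp: indep_def)
  qed
  ultimately show ?thesis by blast
qed

text \<open>
  The identity matchings encode ordinary proper colouring; this is the inequality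
  \<open>\<chi> \<le> \<chi>\<^sub>D\<^sub>P\<close>.
\<close>

lemma proper_coloring_if_dp_colorable:
  assumes "simple_graph G" "dp_colorable k G"
  shows "\<exists>c. proper_coloring G k c"
  using dp_colorable_relation[OF assms, of "\<lambda>u v i j. i = j"]
  unfolding proper_coloring_def by auto

lemma proper_coloring_chromatic_number:
  assumes "simple_graph G"
  shows "\<exists>c. proper_coloring G (chromatic_number G) c"
proof -
  have "\<exists>c. proper_coloring G (card (verts G)) c"
    using assms dp_colorable_card[of G] proper_coloring_if_dp_colorable[OF assms]
    unfolding simple_graph_def by blast
  then show ?thesis unfolding chromatic_number_def by (rule LeastI)
qed

lemma dp_chromatic_number_eqI:
  assumes G: "simple_graph G" and "0 < chromatic_number G" "dp_colorable (chromatic_number G) G"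
  shows "dp_chromatic_number G = chromatic_number G"
  unfolding dp_chromatic_number_def
proof (rule Least_equality)
  fix m assume "0 < m \<and> dp_colorable m G"
  then have "\<exists>c. proper_coloring G m c" using G proper_coloring_if_dp_colorable by blast
  then show "chromatic_number G \<le> m" unfolding chromatic_number_def by (rule Least_le)
qed (use assms in simp)

text \<open>
  The minimum is attained because one colour per vertex always suffices for greedy colouring.
\<close>

lemma dp_colorable_dp_chromatic_number:
  assumes "simple_graph G"
  shows "dp_colorable (dp_chromatic_number G) G"
proof -
  have "0 < Suc (card (verts G)) \<and> dp_colorable (Suc (card (verts G))) G"
    using assms dp_colorable_card[of G "Suc (card (verts G))"] by (simp add: simple_graph_def)
  then show ?thesis unfolding dp_chromatic_number_def by (rule LeastI2) simp
qed

section \<open>The wheel with lists of three colours\<close>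

definition partial_matching :: "('b \<Rightarrow> 'b \<Rightarrow> bool) \<Rightarrow> 'b set \<Rightarrow> 'b set \<Rightarrow> bool" where
  "partial_matching R X Y \<longleftrightarrow>
     (\<forall>x\<in>X. \<forall>y\<in>Y. \<forall>y'\<in>Y. R x y \<longrightarrow> R x y' \<longrightarrow> y = y') \<and>
     (\<forall>x\<in>X. \<forall>x'\<in>X. \<forall>y\<in>Y. R x y \<longrightarrow> R x' y \<longrightarrow> x = x')"

text \<open>
  Lists and conflicts on the wheel with hub \<open>W\<close> and rim \<open>A, B, A', B'\<close> in cyclic order; \<open>A, A'\<close> and
  \<open>B, B'\<close> are its two nonadjacent pairs. Lists have exactly three colours, so that a conflict
  partner for every hub colour exhausts a rim list.
\<close>

definition wheel_lists ::
  "('b \<Rightarrow> 'b \<Rightarrow> bool) \<Rightarrow> 'b set \<Rightarrow> 'b set \<Rightarrow> 'b set \<Rightarrow> 'b set \<Rightarrow> 'b set \<Rightarrow> bool" where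
  "wheel_lists R W A A' B B' \<longleftrightarrow> symp R \<and>
     card W = 3 \<and> card A = 3 \<and> card A' = 3 \<and> card B = 3 \<and> card B' = 3 \<and>
     partial_matching R W A \<and> partial_matching R W A' \<and>
     partial_matching R W B \<and> partial_matching R W B' \<and>
     partial_matching R A B \<and> partial_matching R A B' \<and>
     partial_matching R A' B \<and> partial_matching R A' B'"

definition wheel_choice ::
  "('b \<Rightarrow> 'b \<Rightarrow> bool) \<Rightarrow> 'b set \<Rightarrow> 'b set \<Rightarrow> 'b set \<Rightarrow> 'b set \<Rightarrow> 'b set \<Rightarrow> bool" where
  "wheel_choice R W A A' B B' \<longleftrightarrow> (\<exists>w\<in>W. \<exists>a\<in>A. \<exists>a'\<in>A'. \<exists>b\<in>B. \<exists>b'\<in>B'.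
     \<not> R w a \<and> \<not> R w a' \<and> \<not> R w b \<and> \<not> R w b' \<and>
     \<not> R a b \<and> \<not> R a b' \<and> \<not> R a' b \<and> \<not> R a' b')"

lemma partial_matching_sym: "symp R \<Longrightarrow> partial_matching R X Y \<Longrightarrow> partial_matching R Y X"
  unfolding partial_matching_def by (meson sympD)

lemma partial_matching_unique:
  assumes "partial_matching R X Y"
  shows "\<lbrakk>x \<in> X; y \<in> Y; y' \<in> Y; R x y; R x y'\<rbrakk> \<Longrightarrow> y = y'"
    and "\<lbrakk>x \<in> X; x' \<in> X; y \<in> Y; R x y; R x' y\<rbrakk> \<Longrightarrow> x = x'"
  using assms unfolding partial_matching_def by blast+

text \<open>
  These symmetries of the wheel generate all that are needed to transfer a statement about \<open>A\<close>,
  or about the pair \<open>A, B\<close>, to the other rim vertices and rim edges.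
\<close>

lemma wheel_lists_swap:
  assumes "wheel_lists R W A A' B B'"
  shows "wheel_lists R W A' A B B'" "wheel_lists R W A A' B' B" "wheel_lists R W B B' A A'"
  using assms unfolding wheel_lists_def by (auto intro: partial_matching_sym)

lemma wheel_choice_swap:
  shows "wheel_choice R W A' A B B' \<Longrightarrow> wheel_choice R W A A' B B'"
    and "wheel_choice R W A A' B' B \<Longrightarrow> wheel_choice R W A A' B B'"
    and "symp R \<Longrightarrow> wheel_choice R W B B' A A' \<Longrightarrow> wheel_choice R W A A' B B'"
  subgoal unfolding wheel_choice_def by blast
  subgoal unfolding wheel_choice_def by blast
  subgoal unfolding wheel_choice_def by (elim bexE, intro bexI) (auto dest: sympD)
  done

lemma avoid_one:
  assumes "partial_matching R X Y" "x \<in> X" "Z \<subseteq> Y" "2 \<le> card Z"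
  shows "\<exists>y\<in>Z. \<not> R x y"
proof (rule ccontr)
  assume "\<not> ?thesis"
  then have "\<forall>y\<in>Z. \<forall>y'\<in>Z. y = y'"
    using assms unfolding partial_matching_def by blast
  then have "card Z \<le> 1"
    by (cases "finite Z") (auto simp: card_le_Suc0_iff_eq)
  then show False using assms by simp
qed

lemma avoid_hub:
  assumes "partial_matching R W X" "h \<in> W" "card X = 3"
  shows "2 \<le> card {x \<in> X. \<not> R h x}"
proof -
  have fin: "finite X" using assms by (simp add: card_ge_0_finite)
  have "card {x \<in> X. R h x} \<le> 1"
    using assms fin unfolding partial_matching_def by (auto simp: card_le_Suc0_iff_eq)
  moreover have "card X = card {x \<in> X. R h x} + card {x \<in> X. \<not> R h x}"
    using fin by (subst card_Un_disjoint[symmetric]) (auto intro: arg_cong[where f = card])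
  ultimately show ?thesis using assms by simp
qed

text \<open>
  If the hub colour \<open>h\<close> takes nothing from \<open>A\<close>, then three colours remain there and at least two on
  the other rim vertices: colour the path \<open>b, a', b'\<close> greedily and finish with \<open>a\<close>, which has
  only two rim neighbours.
\<close>

lemma hub_color_blocks_rim:
  assumes wl: "wheel_lists R W A A' B B'" and no: "\<not> wheel_choice R W A A' B B'" and h: "h \<in> W"
  shows "\<exists>x\<in>A. R h x"
proof (rule ccontr)
  assume free: "\<not> ?thesis"
  have big: "2 \<le> card {x \<in> X. \<not> R h x}" if "X \<in> {A', B, B'}" for X
    using avoid_hub[of R W X h] wl h that unfolding wheel_lists_def by blast
  obtain b where b: "b \<in> B" "\<not> R h b"
    using big[of B] by (metis (no_types, lifting) card.empty empty_Collect_eq insertCI not_numeral_le_zero)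
  obtain a' where a': "a' \<in> A'" "\<not> R h a'" "\<not> R b a'"
    using avoid_one[of R B A' b "{x \<in> A'. \<not> R h x}"] wl b big partial_matching_sym[of R A' B]
    unfolding wheel_lists_def by auto
  obtain b' where b': "b' \<in> B'" "\<not> R h b'" "\<not> R a' b'"
    using avoid_one[of R A' B' a' "{x \<in> B'. \<not> R h x}"] wl a' big
    unfolding wheel_lists_def by auto
  have "2 \<le> card {x \<in> A. \<not> R b x}"
    using avoid_hub[of R B A b] wl b partial_matching_sym[of R A B] unfolding wheel_lists_def by auto
  then obtain a where a: "a \<in> A" "\<not> R b a" "\<not> R b' a"
    using avoid_one[of R B' A b' "{x \<in> A. \<not> R b x}"] wl b' partial_matching_sym[of R A B']
    unfolding wheel_lists_def by auto
  have sR: "symp R" using wl unfolding wheel_lists_def by blast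
  have "\<not> R h a" using free a by blast
  moreover have "\<not> R a b" "\<not> R a b'" "\<not> R a' b" using a a' sympD[OF sR] by blast+
  ultimately have "wheel_choice R W A A' B B'"
    unfolding wheel_choice_def using h a(1) a'(1,2) b b' by blast
  then show False using no by blast
qed

text \<open>
  The hub colours have distinct partners in \<open>A\<close>, and there are as many of them as colours in \<open>A\<close>.
\<close>

lemma rim_color_blocked_by_hub:
  assumes wl: "wheel_lists R W A A' B B'" and no: "\<not> wheel_choice R W A A' B B'" and x: "x \<in> A"
  shows "\<exists>h\<in>W. R h x"
proof -
  obtain f where f: "\<And>h. h \<in> W \<Longrightarrow> f h \<in> A \<and> R h (f h)"
    using hub_color_blocks_rim[OF wl no] by metis
  have wf: "partial_matching R W A" "card W = 3" "card A = 3"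
    using wl unfolding wheel_lists_def by auto
  have "inj_on f W"
    using f wf(1) unfolding partial_matching_def by (metis inj_onI)
  then have "card (f ` W) = card A" using wf by (simp add: card_image)
  moreover have "finite A" using wf by (simp add: card_ge_0_finite)
  ultimately have "f ` W = A" using f by (intro card_subset_eq) auto
  then show ?thesis using x f by auto
qed

text \<open>
  Suppose the partner \<open>y\<close> of \<open>x\<close> belongs to a hub colour \<open>j\<close> other than \<open>h\<close>. Choosing \<open>j\<close> at the hub
  removes \<open>y\<close> but keeps \<open>x\<close>, so \<open>x\<close> no longer conflicts with anything left in \<open>B\<close>. Then
  \<open>x, b', a', b\<close> can be chosen in this order, each with at most one earlier
  rim neighbour that can still conflict.
\<close>

lemma rim_matching_aligned:
  assumes wl: "wheel_lists R W A A' B B'" and no: "\<not> wheel_choice R W A A' B B'"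
    and h: "h \<in> W" and x: "x \<in> A" "R h x" and y: "y \<in> B" "R x y"
  shows "R h y"
proof (rule ccontr)
  assume nhy: "\<not> R h y"
  have sR: "symp R" and WA: "partial_matching R W A" and AB: "partial_matching R A B"
    using wl unfolding wheel_lists_def by blast+
  obtain j where j: "j \<in> W" "R j y"
    using rim_color_blocked_by_hub[OF wheel_lists_swap(3)[OF wl] _ y(1)] no wheel_choice_swap(3)[OF sR]
    by blast
  have "j \<noteq> h" using j nhy by blast
  then have njx: "\<not> R j x"
    using partial_matching_unique(2)[OF WA j(1) h x(1) _ x(2)] by blast
  have big: "2 \<le> card {z \<in> X. \<not> R j z}" if "X \<in> {A', B, B'}" for X
    using avoid_hub[of R W X j] wl j that unfolding wheel_lists_def by blast
  obtain b' where b': "b' \<in> B'" "\<not> R j b'" "\<not> R x b'"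
    using avoid_one[of R A B' x "{z \<in> B'. \<not> R j z}"] wl x big unfolding wheel_lists_def by auto
  obtain a' where a': "a' \<in> A'" "\<not> R j a'" "\<not> R b' a'"
    using avoid_one[of R B' A' b' "{z \<in> A'. \<not> R j z}"] wl b' big partial_matching_sym[of R A' B']
    unfolding wheel_lists_def by auto
  obtain b where b: "b \<in> B" "\<not> R j b" "\<not> R a' b"
    using avoid_one[of R A' B a' "{z \<in> B. \<not> R j z}"] wl a' big unfolding wheel_lists_def by auto
  have "\<not> R x b"
    using partial_matching_unique(1)[OF AB x(1) y(1) b(1) y(2)] b(2) j(2) by blast
  moreover have "\<not> R a' b'" using a' sympD[OF sR] by blast
  ultimately have "wheel_choice R W A A' B B'"
    unfolding wheel_choice_def using j(1) njx x(1) b b' a'(1,2) by blast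
  then show False using no by blast
qed

text \<open>
  By alignment each list is indexed by the three hub colours, with conflicts only between equal
  indices. Giving one index to the hub, another to \<open>a, a'\<close> and the third to \<open>b, b'\<close> avoids all
  conflicts.
\<close>

lemma wheel_choice_exists:
  assumes wl: "wheel_lists R W A A' B B'"
  shows "wheel_choice R W A A' B B'"
proof (rule ccontr)
  assume no: "\<not> ?thesis"
  have sR: "symp R" and cW: "card W = 3" using wl unfolding wheel_lists_def by blast+
  note sw = wheel_lists_swap[OF wl]
  have no1: "\<not> wheel_choice R W A' A B B'" using no wheel_choice_swap(1) by blast
  have no2: "\<not> wheel_choice R W A A' B' B" using no wheel_choice_swap(2) by blast
  have no3: "\<not> wheel_choice R W B B' A A'" using no wheel_choice_swap(3)[OF sR] by blast
  have no4: "\<not> wheel_choice R W A' A B' B" using no2 wheel_choice_swap(1) by blast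
  have no5: "\<not> wheel_choice R W B' B A A'" using no3 wheel_choice_swap(1) by blast
  obtain h i j where hij: "W = {h, i, j}" "h \<noteq> i" "h \<noteq> j" "i \<noteq> j"
    using cW by (auto simp: card_3_iff)
  then have W: "h \<in> W" "i \<in> W" "j \<in> W" by auto
  obtain a where a: "a \<in> A" "R i a" using hub_color_blocks_rim[OF wl no W(2)] by blast
  obtain a' where a': "a' \<in> A'" "R i a'" using hub_color_blocks_rim[OF sw(1) no1 W(2)] by blast
  obtain b where b: "b \<in> B" "R j b" using hub_color_blocks_rim[OF sw(3) no3 W(3)] by blast
  obtain b' where b': "b' \<in> B'" "R j b'"
    using hub_color_blocks_rim[OF wheel_lists_swap(1)[OF sw(3)] no5 W(3)] by blast
  have WX: "partial_matching R W A" "partial_matching R W A'"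
    "partial_matching R W B" "partial_matching R W B'"
    using wl unfolding wheel_lists_def by blast+
  have hub: "\<not> R h a" "\<not> R h a'" "\<not> R h b" "\<not> R h b'" "\<not> R i b" "\<not> R i b'"
    using partial_matching_unique(2)[OF WX(1) _ _ a(1) _ a(2)]
      partial_matching_unique(2)[OF WX(2) _ _ a'(1) _ a'(2)]
      partial_matching_unique(2)[OF WX(3) _ _ b(1) _ b(2)]
      partial_matching_unique(2)[OF WX(4) _ _ b'(1) _ b'(2)] W hij(2-4) by blast+
  have "\<not> R a b" using rim_matching_aligned[OF wl no W(2) a b(1)] hub by blast
  moreover have "\<not> R a b'" using rim_matching_aligned[OF sw(2) no2 W(2) a b'(1)] hub by blast
  moreover have "\<not> R a' b" using rim_matching_aligned[OF sw(1) no1 W(2) a' b(1)] hub by blast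
  moreover have "\<not> R a' b'"
    using rim_matching_aligned[OF wheel_lists_swap(2)[OF sw(1)] no4 W(2) a' b'(1)] hub by blast
  ultimately show False using no hub a a' b b' W unfolding wheel_choice_def by blast
qed

section \<open>Graphs of chromatic number \<open>n - 2\<close>\<close>

text \<open>
  Some colour repeats, and it still does after one of two equally coloured vertices is deleted. The
  second pair either avoids the first, or meets it and yields three vertices of one colour.
\<close>

lemma two_repeated_colors:
  assumes G: "simple_graph G" and col: "proper_coloring G k c" and n: "card (verts G) = k + 2"
  shows "(\<exists>x y z. {x, y, z} \<subseteq> verts G \<and> card {x, y, z} = 3 \<and>
            {x, y} \<notin> edges G \<and> {x, z} \<notin> edges G \<and> {y, z} \<notin> edges G) \<or>
         (\<exists>a a' b b'. {a, a', b, b'} \<subseteq> verts G \<and> card {a, a', b, b'} = 4 \<and>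
            {a, a'} \<notin> edges G \<and> {b, b'} \<notin> edges G)"
proof -
  have fin: "finite (verts G)" using G by (simp add: simple_graph_def)
  have rep: "\<exists>x\<in>S. \<exists>y\<in>S. x \<noteq> y \<and> c x = c y" if "S \<subseteq> verts G" "k < card S" for S
  proof -
    have "c ` S \<subseteq> {..<k}" using col that by (auto simp: proper_coloring_def)
    then have "card (c ` S) \<le> k" using card_mono[of "{..<k}" "c ` S"] by simp
    then have "\<not> inj_on c S" using that by (auto simp: card_image)
    then show ?thesis by (auto simp: inj_on_def)
  qed
  have same: "{u, v} \<notin> edges G" if "u \<in> verts G" "v \<in> verts G" "c u = c v" for u v
    using col that by (auto simp: proper_coloring_def)
  obtain a a' where a: "a \<in> verts G" "a' \<in> verts G" "a \<noteq> a'" "c a = c a'"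
    using rep[of "verts G"] n by auto
  have "k < card (verts G - {a'})" using n a fin by simp
  then obtain b b' where b: "b \<in> verts G" "b' \<in> verts G" "b \<noteq> a'" "b' \<noteq> a'" "b \<noteq> b'" "c b = c b'"
    using rep[of "verts G - {a'}"] by auto
  show ?thesis
  proof (cases "a \<in> {b, b'}")
    case True
    then obtain z where z: "z \<in> verts G" "z \<noteq> a" "z \<noteq> a'" "c z = c a" using b by auto
    have "card {a, a', z} = 3" using a z by auto
    then show ?thesis using a z same by (intro disjI1 exI[of _ a] exI[of _ a'] exI[of _ z]) auto
  next
    case False
    then have "card {a, a', b, b'} = 4" using a b by auto
    then show ?thesis
      using a b same by (intro disjI2 exI[of _ a] exI[of _ a'] exI[of _ b] exI[of _ b']) auto
  qed
qed

text \<open>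
  Each of the three independent vertices has its neighbours among the remaining \<open>m - 1\<close> vertices,
  so they can be coloured last.
\<close>

lemma coloring_three_independent:
  assumes G: "simple_graph G" and cov: "fold_cover m G L H" and n: "card (verts G) = m + 2"
    and xyz: "{x, y, z} \<subseteq> verts G" "card {x, y, z} = 3"
    and ne: "{x, y} \<notin> edges G" "{x, z} \<notin> edges G" "{y, z} \<notin> edges G"
  shows "\<exists>c. partial_coloring L H (verts G) c"
proof -
  let ?S = "verts G - {x, y, z}"
  have dp: "dp_cover G L H" and cL: "\<And>v. v \<in> verts G \<Longrightarrow> card (L v) = m"
    using cov by (auto simp: fold_cover_def)
  have fin: "finite (verts G)" using G by (simp add: simple_graph_def)
  have d: "x \<noteq> y" "x \<noteq> z" "y \<noteq> z" using xyz(2) by (auto simp: card_insert_if split: if_splits)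
  have cS: "card ?S = m - 1" "m \<ge> 1"
    using n xyz fin card_mono[of "verts G" "{x, y, z}"] by (auto simp: card_Diff_subset)
  obtain c0 where "partial_coloring L H ?S c0"
    using greedy_small_set[OF cov, of ?S] fin cS by auto
  then obtain c1 where "partial_coloring L H (insert x ?S) c1"
    using greedy_step[OF dp, of ?S x ?S c0] fin cS cL xyz by auto
  then obtain c2 where "partial_coloring L H (insert y (insert x ?S)) c2"
    using greedy_step[OF dp, of "insert x ?S" y ?S c1] fin cS cL xyz d ne by auto
  then obtain c3 where "partial_coloring L H (insert z (insert y (insert x ?S))) c3"
    using greedy_step[OF dp, of "insert y (insert x ?S)" z ?S c2] fin cS cL xyz d ne by auto
  moreover have "insert z (insert y (insert x ?S)) = verts G" using xyz by auto
  ultimately show ?thesis by metis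
qed

text \<open>
  The missing edge leaves at most the path \<open>a, b', a', b\<close>; colouring along it, each vertex has at
  most one earlier neighbour.
\<close>

lemma coloring_path:
  assumes cov: "fold_cover 2 G L H"
    and V: "verts G = {a, a', b, b'}" "card {a, a', b, b'} = 4"
    and ne: "{a, a'} \<notin> edges G" "{b, b'} \<notin> edges G" "{a, b} \<notin> edges G"
  shows "\<exists>c. partial_coloring L H (verts G) c"
proof -
  have dp: "dp_cover G L H" and cL: "\<And>v. v \<in> verts G \<Longrightarrow> card (L v) = 2"
    using cov by (auto simp: fold_cover_def)
  have d: "a \<noteq> a'" "a \<noteq> b" "a \<noteq> b'" "a' \<noteq> b" "a' \<noteq> b'" "b \<noteq> b'"
    using V(2) by (auto simp: card_insert_if split: if_splits)
  obtain c0 where "partial_coloring L H {a, b'} c0"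
    using greedy_small_set[OF cov, of "{a, b'}"] V d by auto
  then obtain c1 where "partial_coloring L H {a', a, b'} c1"
    using greedy_step[OF dp, of "{a, b'}" a' "{b'}" c0] cL V d ne by auto
  moreover have "{b', b} \<notin> edges G" using ne(2) by (simp add: insert_commute)
  then have "{u \<in> {a', a, b'}. {u, b} \<in> edges G} \<subseteq> {a'}" using ne(3) by auto
  ultimately obtain c2 where "partial_coloring L H {b, a', a, b'} c2"
    using greedy_step[OF dp, of "{a', a, b'}" b "{a'}" c1] cL V d by auto
  moreover have "{b, a', a, b'} = verts G" using V by auto
  ultimately show ?thesis by metis
qed

lemma verts_cycle4: "verts (cycle_graph 4) = {0, 1, 2, 3}"
  by (auto simp: cycle_graph_def)

lemma edges_cycle4: "edges (cycle_graph 4) = {{0, 1}, {1, 2}, {2, 3}, {3, 0}}"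
proof -
  have "edges (cycle_graph 4) = (\<lambda>i. {i, Suc i mod 4}) ` verts (cycle_graph 4)"
    by (auto simp: cycle_graph_def)
  then show ?thesis by (simp add: verts_cycle4 One_nat_def[symmetric] del: One_nat_def)
qed

lemma graph_iso_cycle4:
  assumes G: "simple_graph G" and V: "verts G = {a, a', b, b'}" "card {a, a', b, b'} = 4"
    and ne: "{a, a'} \<notin> edges G" "{b, b'} \<notin> edges G"
    and e: "{a, b} \<in> edges G" "{a, b'} \<in> edges G" "{a', b} \<in> edges G" "{a', b'} \<in> edges G"
  shows "graph_iso G (cycle_graph 4)"
proof -
  have d: "a \<noteq> a'" "a \<noteq> b" "a \<noteq> b'" "a' \<noteq> b" "a' \<noteq> b'" "b \<noteq> b'"
    using V(2) by (auto simp: card_insert_if split: if_splits)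
  have noloop: "{u} \<notin> edges G" for u
    using G by (auto simp: simple_graph_def nsets_def)
  let ?f = "(\<lambda>_. 0 :: nat)(b := 1, a' := 2, b' := 3)"
  have "bij_betw ?f (verts G) (verts (cycle_graph 4))"
    using d V(1) by (auto simp: verts_cycle4 bij_betw_def inj_on_def)
  moreover have "\<forall>u\<in>verts G. \<forall>v\<in>verts G.
      {u, v} \<in> edges G \<longleftrightarrow> {?f u, ?f v} \<in> edges (cycle_graph 4)"
    using V(1) d ne e noloop by (simp add: edges_cycle4 doubleton_eq_iff insert_commute)
  ultimately show ?thesis unfolding graph_iso_def by blast
qed

text \<open>
  The fifth vertex \<open>w\<close> serves as the hub of a wheel. All other vertices number \<open>m - 3\<close>, and
  colouring them first costs every wheel vertex at most \<open>m - 3\<close> of its \<open>m\<close> colours.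
\<close>

lemma coloring_two_pairs:
  assumes G: "simple_graph G" and cov: "fold_cover m G L H" and n: "card (verts G) = m + 2"
    and sub: "{a, a', b, b', w} \<subseteq> verts G" and c5: "card {a, a', b, b', w} = 5"
    and ne: "{a, a'} \<notin> edges G" "{b, b'} \<notin> edges G"
  shows "\<exists>c. partial_coloring L H (verts G) c"
proof -
  let ?S = "verts G - {a, a', b, b', w}"
  define R where "R = (\<lambda>x y. {x, y} \<in> edges H)"
  have dp: "dp_cover G L H" and cL: "\<And>v. v \<in> verts G \<Longrightarrow> card (L v) = m"
    using cov by (auto simp: fold_cover_def)
  have fin: "finite (verts G)" using G by (simp add: simple_graph_def)
  have d: "a \<noteq> a'" "a \<noteq> b" "a \<noteq> b'" "a' \<noteq> b" "a' \<noteq> b'" "b \<noteq> b'" "a \<noteq> w" "a' \<noteq> w" "b \<noteq> w" "b' \<noteq> w"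
    using c5 by (auto simp: card_insert_if split: if_splits)
  have cS: "card ?S = m - 3" "m \<ge> 3"
    using n sub c5 fin card_mono[of "verts G" "{a, a', b, b', w}"] by (auto simp: card_Diff_subset)
  obtain c where c: "partial_coloring L H ?S c"
    using greedy_small_set[OF cov, of ?S] fin cS by auto
  have "\<exists>M \<subseteq> available L H ?S c v. card M = 3" if v: "v \<in> {a, a', b, b', w}" for v
  proof -
    have "v \<in> verts G" using sub v by blast
    moreover have "card {u \<in> ?S. {u, v} \<in> edges G} \<le> m - 3"
      using card_mono[of ?S "{u \<in> ?S. {u, v} \<in> edges G}"] fin cS by auto
    moreover have "v \<notin> ?S" using v by simp
    ultimately have "3 \<le> card (available L H ?S c v)"
      using card_list_le_available[OF dp _ _ _ _ c, of v] cL[of v] fin cS by fastforce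
    then show ?thesis by (meson obtain_subset_with_card_n)
  qed
  then obtain M where M: "\<And>v. v \<in> {a, a', b, b', w} \<Longrightarrow> M v \<subseteq> available L H ?S c v \<and> card (M v) = 3"
    by metis
  have pm: "partial_matching R (M u) (M v)" if uv: "u \<in> {a, a', b, b', w}" "v \<in> {a, a', b, b', w}" "u \<noteq> v" for u v
  proof -
    have sL: "M u \<subseteq> L u" "M v \<subseteq> L v" and V: "u \<in> verts G" "v \<in> verts G"
      using M uv sub by (auto simp: available_def)
    show ?thesis unfolding partial_matching_def R_def
    proof (intro conjI ballI impI)
      fix x y y' assume *: "x \<in> M u" "y \<in> M v" "y' \<in> M v" "{x, y} \<in> edges H" "{x, y'} \<in> edges H"
      then have "x \<in> L u" "y \<in> L v" "y' \<in> L v" using sL by auto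
      then show "y = y'" using cover_matching[OF dp V uv(3)] *(4,5) by blast
    next
      fix x x' y assume *: "x \<in> M u" "x' \<in> M u" "y \<in> M v" "{x, y} \<in> edges H" "{x', y} \<in> edges H"
      then have "x \<in> L u" "x' \<in> L u" "y \<in> L v" using sL by auto
      moreover have "{y, x} \<in> edges H" "{y, x'} \<in> edges H" using *(4,5) by (simp_all add: insert_commute)
      ultimately show "x = x'" using cover_matching[OF dp V(2,1) uv(3)[symmetric]] by blast
    qed
  qed
  have "wheel_lists R (M w) (M a) (M a') (M b) (M b')"
    unfolding wheel_lists_def using M pm d by (auto simp: symp_def R_def insert_commute)
  then have "wheel_choice R (M w) (M a) (M a') (M b) (M b')" by (rule wheel_choice_exists)
  then obtain xw xa xa' xb xb' where
    x: "xw \<in> M w" "xa \<in> M a" "xa' \<in> M a'" "xb \<in> M b" "xb' \<in> M b'" and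
    r: "{xw, xa} \<notin> edges H" "{xw, xa'} \<notin> edges H" "{xw, xb} \<notin> edges H" "{xw, xb'} \<notin> edges H"
      "{xa, xb} \<notin> edges H" "{xa, xb'} \<notin> edges H" "{xa', xb} \<notin> edges H" "{xa', xb'} \<notin> edges H"
    unfolding wheel_choice_def R_def by blast
  have av: "xw \<in> available L H ?S c w" "xa \<in> available L H ?S c a" "xa' \<in> available L H ?S c a'"
    "xb \<in> available L H ?S c b" "xb' \<in> available L H ?S c b'"
    using x M by blast+
  then have "xa \<in> L a" "xa' \<in> L a'" "xb \<in> L b" "xb' \<in> L b'" by (auto simp: available_def)
  then have r': "{xa, xa'} \<notin> edges H" "{xb, xb'} \<notin> edges H"
    using cover_nonadjacent[OF dp] sub d ne by auto
  define c1 where "c1 = c(w := xw)"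
  define c2 where "c2 = c1(a := xa)"
  define c3 where "c3 = c2(a' := xa')"
  define c4 where "c4 = c3(b := xb)"
  have "partial_coloring L H (insert w ?S) c1"
    unfolding c1_def by (rule partial_coloring_insert[OF c]) (use av in auto)
  then have "partial_coloring L H (insert a (insert w ?S)) c2"
    unfolding c2_def by (rule partial_coloring_insert) (use av r d in \<open>auto simp: available_def c1_def\<close>)
  then have "partial_coloring L H (insert a' (insert a (insert w ?S))) c3"
    unfolding c3_def by (rule partial_coloring_insert)
      (use av r r' d in \<open>auto simp: available_def c1_def c2_def\<close>)
  then have "partial_coloring L H (insert b (insert a' (insert a (insert w ?S)))) c4"
    unfolding c4_def by (rule partial_coloring_insert)
      (use av r r' d in \<open>auto simp: available_def c1_def c2_def c3_def\<close>)
  then have "partial_coloring L H (insert b' (insert b (insert a' (insert a (insert w ?S))))) (c4(b' := xb'))"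
    by (rule partial_coloring_insert)
      (use av r r' d in \<open>auto simp: available_def c1_def c2_def c3_def c4_def\<close>)
  moreover have "insert b' (insert b (insert a' (insert a (insert w ?S)))) = verts G"
    using sub by auto
  ultimately show ?thesis by metis
qed

lemma dp_chromatic_number_n_minus_2:
  assumes G: "simple_graph G" and n: "card (verts G) = chromatic_number G + 2"
    and niso: "\<not> graph_iso G (cycle_graph 4)"
  shows "dp_chromatic_number G = chromatic_number G"
proof (rule dp_chromatic_number_eqI[OF G])
  let ?k = "chromatic_number G"
  obtain c where c: "proper_coloring G ?k c" using proper_coloring_chromatic_number[OF G] by blast
  have "verts G \<noteq> {}" using n by auto
  then show "0 < ?k" using c by (auto simp: proper_coloring_def)
  show "dp_colorable ?k G"
    unfolding dp_colorable_def
  proof (intro allI impI)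
    fix L and H :: "nat graph" assume cov: "fold_cover ?k G L H"
    from two_repeated_colors[OF G c n] have "\<exists>c. partial_coloring L H (verts G) c"
    proof (elim disjE exE conjE)
      fix x y z
      assume "{x, y, z} \<subseteq> verts G" "card {x, y, z} = 3"
        "{x, y} \<notin> edges G" "{x, z} \<notin> edges G" "{y, z} \<notin> edges G"
      then show ?thesis by (rule coloring_three_independent[OF G cov n])
    next
      fix a a' b b'
      assume sub: "{a, a', b, b'} \<subseteq> verts G" and c4: "card {a, a', b, b'} = 4"
        and ne: "{a, a'} \<notin> edges G" "{b, b'} \<notin> edges G"
      show ?thesis
      proof (cases "verts G = {a, a', b, b'}")
        case True
        then have "?k = 2" using n c4 by simp
        then have cov2: "fold_cover 2 G L H" using cov by simp
        have perm: "{a, a', b', b} = {a, a', b, b'}" "{a', a, b, b'} = {a, a', b, b'}"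
          "{a', a, b', b} = {a, a', b, b'}" by auto
        have ne': "{a', a} \<notin> edges G" "{b', b} \<notin> edges G" using ne by (simp_all add: insert_commute)
        consider "{a, b} \<notin> edges G" | "{a, b'} \<notin> edges G" | "{a', b} \<notin> edges G" | "{a', b'} \<notin> edges G"
          using graph_iso_cycle4[OF G True c4 ne] niso by blast
        then show ?thesis
          using coloring_path[OF cov2, of a a' b b'] coloring_path[OF cov2, of a a' b' b]
            coloring_path[OF cov2, of a' a b b'] coloring_path[OF cov2, of a' a b' b]
            True c4 ne ne' unfolding perm by cases metis+
      next
        case False
        then obtain w where "w \<in> verts G" "w \<notin> {a, a', b, b'}" using sub by blast
        then have "{a, a', b, b', w} \<subseteq> verts G" "card {a, a', b, b', w} = 5"
          using sub c4 by (auto simp: card_insert_if split: if_splits)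
        then show ?thesis using coloring_two_pairs[OF G cov n] ne by blast
      qed
    qed
    then show "cover_colorable G H"
      using cov cover_colorable_if_coloring by (auto simp: fold_cover_def)
  qed
qed

section \<open>The four-cycle and the four-wheel\<close>

lemma chromatic_number_eqI:
  assumes "proper_coloring G k c"
    and Q: "Q \<subseteq> verts G" "card Q = k" "\<And>u v. \<lbrakk>u \<in> Q; v \<in> Q; u \<noteq> v\<rbrakk> \<Longrightarrow> {u, v} \<in> edges G"
  shows "chromatic_number G = k"
  unfolding chromatic_number_def
proof (rule Least_equality)
  show "\<exists>c. proper_coloring G k c" using assms(1) by blast
  fix l assume "\<exists>c. proper_coloring G l c"
  then obtain c' where c': "proper_coloring G l c'" by blast
  then have "inj_on c' Q" using Q unfolding proper_coloring_def inj_on_def by blast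
  moreover have "c' ` Q \<subseteq> {..<l}" using c' Q unfolding proper_coloring_def by blast
  ultimately show "k \<le> l" using Q(2) card_inj_on_le[of c' Q "{..<l}"] by simp
qed

lemma simple_graph_join:
  assumes "simple_graph G1" "simple_graph G2"
  shows "simple_graph (G1 \<or>\<^sub>g G2)"
proof -
  have "Inl ` e \<subseteq> verts G1 <+> verts G2 \<and> finite (Inl ` e) \<and> card (Inl ` e) = 2"
    if "e \<in> edges G1" for e
    using assms(1) that by (auto simp: simple_graph_def nsets_def card_image)
  moreover have "Inr ` e \<subseteq> verts G1 <+> verts G2 \<and> finite (Inr ` e) \<and> card (Inr ` e) = 2"
    if "e \<in> edges G2" for e
    using assms(2) that by (auto simp: simple_graph_def nsets_def card_image)
  ultimately show ?thesis
    using assms unfolding simple_graph_def graph_join_def by (auto simp: nsets_def)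
qed

lemma join_edge_Inl: "{Inl u, Inl v} \<in> edges (G1 \<or>\<^sub>g G2) \<longleftrightarrow> {u, v} \<in> edges G1"
proof -
  have "inj ((`) Inl)" by (simp add: inj_def inj_image_eq_iff)
  then have "{Inl u, Inl v} \<in> (`) Inl ` edges G1 \<longleftrightarrow> {u, v} \<in> edges G1"
    using inj_image_mem_iff[of "(`) Inl" "{u, v}"] by simp
  moreover have "{Inl u, Inl v} \<noteq> Inr ` e" for e by blast
  then have "{Inl u, Inl v} \<notin> (`) Inr ` edges G2" by blast
  moreover have "{Inl u, Inl v} \<noteq> {Inl x, Inr y}" for x y by blast
  ultimately show ?thesis unfolding graph_join_def graph.simps Un_iff mem_Collect_eq by blast
qed

lemma simple_graph_cycle4: "simple_graph (cycle_graph 4)"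
  by (auto simp: simple_graph_def verts_cycle4 edges_cycle4 nsets_def)

lemma simple_graph_complete: "simple_graph (complete_graph m)"
  by (simp add: simple_graph_def complete_graph_def)

lemma edges_complete_le_1: "m \<le> 1 \<Longrightarrow> edges (complete_graph m) = {}"
  by (auto simp: complete_graph_def nsets_def dest: card_mono[of "{..<m}", rotated])

lemma proper_coloring_cycle4_join_complete:
  assumes "m \<le> 1"
  shows "proper_coloring (cycle_graph 4 \<or>\<^sub>g complete_graph m) (2 + m) (case_sum (\<lambda>i. i mod 2) (\<lambda>_. 2))"
proof -
  let ?G = "cycle_graph 4 \<or>\<^sub>g complete_graph m" and ?c = "case_sum (\<lambda>i. i mod 2) (\<lambda>_. 2)"
  have rim: "{i, j} \<in> edges (cycle_graph 4) \<Longrightarrow> i mod 2 \<noteq> j mod 2" for i j :: nat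
    by (auto simp: edges_cycle4 doubleton_eq_iff)
  have hub: "{Inr i, Inr j} \<notin> edges ?G" for i j
    using edges_complete_le_1[OF assms] by (auto simp: graph_join_def doubleton_eq_iff)
  have less: "i mod 2 < 2" for i :: nat by simp
  show ?thesis
    unfolding proper_coloring_def
  proof (intro conjI ballI impI)
    show "?c ` verts ?G \<subseteq> {..<2 + m}"
      by (auto simp: graph_join_def complete_graph_def intro: less_le_trans[OF less])
    fix u v assume "{u, v} \<in> edges ?G"
    then show "?c u \<noteq> ?c v"
      using rim hub less[THEN less_imp_neq] less[THEN less_imp_neq, symmetric]
      by (cases u; cases v) (auto simp: join_edge_Inl)
  qed
qed

lemma chromatic_number_cycle4_join_complete:
  assumes "m \<le> 1"
  shows "chromatic_number (cycle_graph 4 \<or>\<^sub>g complete_graph m) = 2 + m"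
proof (rule chromatic_number_eqI[OF proper_coloring_cycle4_join_complete[OF assms]])
  let ?G = "cycle_graph 4 \<or>\<^sub>g complete_graph m"
  let ?Q = "Inl ` {0, 1} \<union> Inr ` {..<m} :: (nat + nat) set"
  show "?Q \<subseteq> verts ?G" by (auto simp: graph_join_def verts_cycle4 complete_graph_def)
  have "card ?Q = card (Inl ` {0, 1 :: nat} :: (nat + nat) set) + card (Inr ` {..<m} :: (nat + nat) set)"
    by (rule card_Un_disjoint) auto
  then show "card ?Q = 2 + m" by (simp add: card_image)
  have "{Inl 0, Inl 1} \<in> edges ?G" "{Inl 1, Inl 0} \<in> edges ?G"
    by (auto simp: join_edge_Inl edges_cycle4)
  moreover have "{Inl i, Inr j} \<in> edges ?G" if "i \<in> {0, 1}" "j < m" for i j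
    using that by (auto simp: graph_join_def verts_cycle4 complete_graph_def)
  moreover from this have "{Inr j, Inl i} \<in> edges ?G" if "i \<in> {0, 1}" "j < m" for i j
    using that by (simp add: insert_commute)
  ultimately show "{u, v} \<in> edges ?G" if "u \<in> ?Q" "v \<in> ?Q" "u \<noteq> v" for u v
    using that assms by auto
qed

text \<open>
  The matchings are the identity except for a transposition on one edge. Around the cycle the colour
  must then change exactly three times, which is impossible with two colours.
\<close>

lemma not_dp_colorable_2_cycle4: "\<not> dp_colorable 2 (cycle_graph 4 \<or>\<^sub>g complete_graph 0)"
proof
  let ?G = "cycle_graph 4 \<or>\<^sub>g complete_graph 0"
  define R where "R = (\<lambda>(u :: nat + nat) v (i :: nat) j. ({u, v} = {Inl 0, Inl 3}) = (i \<noteq> j))"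
  assume "dp_colorable 2 ?G"
  then have "\<exists>c. c ` verts ?G \<subseteq> {..<2} \<and>
      (\<forall>u\<in>verts ?G. \<forall>v\<in>verts ?G. {u, v} \<in> edges ?G \<longrightarrow> \<not> R u v (c u) (c v))"
  proof (rule dp_colorable_relation[rotated])
    show "simple_graph ?G" by (intro simple_graph_join simple_graph_cycle4 simple_graph_complete)
    show "R v u j i" if "R u v i j" for u v i j
      using that unfolding R_def by (metis insert_commute)
    show "j = j'" if "i < 2" "j < 2" "j' < 2" "R u v i j" "R u v i j'" for u v i j j'
      using that unfolding R_def by (cases "{u, v} = {Inl 0, Inl 3}") auto
  qed
  then obtain c where less: "c ` verts ?G \<subseteq> {..<2}"
    and c: "\<forall>u\<in>verts ?G. \<forall>v\<in>verts ?G. {u, v} \<in> edges ?G \<longrightarrow> \<not> R u v (c u) (c v)"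
    by (elim exE conjE)
  have V: "Inl i \<in> verts ?G" if "i \<in> {0, 1, 2, 3}" for i
    using that by (auto simp: graph_join_def verts_cycle4)
  have edge: "\<not> R (Inl i) (Inl j) (c (Inl i)) (c (Inl j))"
    if "i \<in> {0, 1, 2, 3}" "j \<in> {0, 1, 2, 3}" "{i, j} \<in> edges (cycle_graph 4)" for i j
    by (rule c[rule_format, OF V V]) (simp_all only: that join_edge_Inl)
  have "c (Inl 0) \<noteq> c (Inl 1)" "c (Inl 1) \<noteq> c (Inl 2)" "c (Inl 2) \<noteq> c (Inl 3)" "c (Inl 3) = c (Inl 0)"
    using edge[of 0 1] edge[of 1 2] edge[of 2 3] edge[of 3 0]
    by (simp_all add: R_def edges_cycle4 doubleton_eq_iff)
  moreover have "c (Inl i) < 2" if "i \<in> {0, 1, 2, 3}" for i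
    using less V[OF that] by blast
  from this[of 0] this[of 1] this[of 2] this[of 3]
  have "c (Inl 0) < 2" "c (Inl 1) < 2" "c (Inl 2) < 2" "c (Inl 3) < 2" by simp_all
  ultimately show False by linarith
qed

lemma Z_DP_cycle4: "Z_DP (cycle_graph 4) = 1"
  unfolding Z_DP_def
proof (rule Least_equality)
  let ?W = "cycle_graph 4 \<or>\<^sub>g complete_graph 1"
  have "card (verts ?W) = 5"
    by (simp add: graph_join_def verts_cycle4 complete_graph_def card_Plus)
  moreover have "\<not> graph_iso ?W (cycle_graph 4)"
    using bij_betw_same_card[of _ "verts ?W" "verts (cycle_graph 4)"] calculation
    by (auto simp: graph_iso_def verts_cycle4)
  ultimately show "dp_chromatic_number ?W = chromatic_number ?W"
    using dp_chromatic_number_n_minus_2[of ?W] chromatic_number_cycle4_join_complete[of 1]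
      simple_graph_join[OF simple_graph_cycle4 simple_graph_complete] by simp
next
  fix m
  let ?G = "cycle_graph 4 \<or>\<^sub>g complete_graph 0"
  have "dp_chromatic_number ?G \<noteq> chromatic_number ?G"
    using dp_colorable_dp_chromatic_number[of ?G] not_dp_colorable_2_cycle4
      chromatic_number_cycle4_join_complete[of 0]
      simple_graph_join[OF simple_graph_cycle4 simple_graph_complete] by auto
  moreover assume "dp_chromatic_number (cycle_graph 4 \<or>\<^sub>g complete_graph m) =
    chromatic_number (cycle_graph 4 \<or>\<^sub>g complete_graph m)"
  ultimately show "1 \<le> m" by (cases m) auto
qed

theorem theorem8:
  shows "Z_DP (cycle_graph 4) = 1 \<and>
    (\<forall>(G :: 'a graph) (n :: nat).
       simple_graph G \<longrightarrow> card (verts G) = n \<longrightarrow>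
       int (chromatic_number G) = int n - 2 \<longrightarrow>
       \<not> graph_iso G (cycle_graph 4) \<longrightarrow>
       dp_chromatic_number G = chromatic_number G)"
proof (intro conjI allI impI)
  show "Z_DP (cycle_graph 4) = 1" by (rule Z_DP_cycle4)
  fix G :: "'a graph" and n :: nat
  assume "simple_graph G" "card (verts G) = n" "int (chromatic_number G) = int n - 2"
    "\<not> graph_iso G (cycle_graph 4)"
  then show "dp_chromatic_number G = chromatic_number G"
    by (intro dp_chromatic_number_n_minus_2) auto
qed

end
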